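(* Let $G$ be a non-elementary, finitely generated group, and let $\mathcal{X}$ be a $G$-space with basepoint $o$. Let $h\in G$ be a strongly contracting element for $G\curvearrowright\mathcal{X}$, and let $[h]$ be its conjugacy class in $G$. Then $\delta_{[h]}\geqslant\frac12\delta_G$. Moreover, let $D:=\operatorname{diam} Z(h)\backslash\mathcal{H}$, where $Z(h)$ is the centralizer of $h$ in $G$, and suppose that $\pi_{\mathcal{H}}\colon\mathcal{X}\to\mathcal{H}$ is a $(1,C)$-strongly constricting, $C$-coarse map. If $d(o,h.o)>15C+2D$, then $\delta_{[h]}=\frac12\delta_G$.
   Context: A group is elementary if it has a finite index cyclic subgroup. A $G$-space is a proper, geodesic metric space $(\mathcal{X},d)$ with a properly discontinuous, isometric action of $G$. For $B\subset G$, $\delta_B:=\limsup_{r\to\infty}\frac1r\log\#\{g\in B\mid d(o,g.o)\leqslant r\}$. A $C$-coarse map $\pi\colon\mathcal{X}\to\mathcal{A}$, $\mathcal{A}\subset\mathcal{X}$, assigns to each point a (nonempty) subset of $\mathcal{A}$ of diameter at most $C$; a coarse map is a $C$-coarse map for some $C\geqslant0$. A coarse map is strongly contracting if there is $C\geqslant 0$ such that: for $a\in\mathcal{A}$, $\pi(a)$ and $\{a\}$ are contained in the closed $C$-neighborhoods of each other; $d(x_0,x_1)<d(x_0,\mathcal{A})-C$ implies $\operatorname{diam}(\pi(x_0)\cup\pi(x_1))\leqslant C$ for all $x_0,x_1\in\mathcal{X}$; and $d(x,\pi(x))-d(x,\mathcal{A})\leqslant C$ for all $x\in\mathcal{X}$.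 A coarse map is $(1,C)$-strongly constricting if for $a\in\mathcal{A}$, $\pi(a)$ and $\{a\}$ are contained in the closed $C$-neighborhoods of each other, and for every geodesic $\mathcal{L}$ with endpoints $x_0,x_1$, if $\operatorname{diam}(\pi(x_0)\cup\pi(x_1))>C$ then $d(\pi(x_i),\mathcal{L})\leqslant C$ for both $i\in\{0,1\}$. An element $h\in G$ is strongly contracting if $i\mapsto h^i.o$ ($i\in\mathbb{Z}$) is a quasi-geodesic (a quasi-isometric embedding) and there exist a subset $\mathcal{A}\subset\mathcal{X}$ on which $\langle h\rangle$ acts cocompactly and a strongly contracting coarse map $\pi\colon\mathcal{X}\to\mathcal{A}$. For such $h$ there is a largest virtually cyclic subgroup $E(h)<G$ containing $h$; the (quasi-)axis of $h$ is $\mathcal{H}:=E(h).o$, and $\pi_{\mathcal{H}}\colon\mathcal{X}\to\mathcal{H}$ denotes an $E(h)$-equivariant strongly contracting coarse map (such maps exist). $\operatorname{diam} Z(h)\backslash\mathcal{H}$ is the diameter of the quotient of $\mathcal{H}$ by $Z(h)$ ($Z(h)\subset E(h)$) in the quotient pseudo-metric. *)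

theory Defs
  imports "HOL-Analysis.Analysis" "HOL-Algebra.Algebra"
begin

section \<open>Groups\<close>

definition finitely_generated :: "('g, 'b) monoid_scheme \<Rightarrow> bool" where
  "finitely_generated G \<longleftrightarrow> (\<exists>S. finite S \<and> S \<subseteq> carrier G \<and> generate G S = carrier G)"

text \<open>\<open>elementary\<close> and "virtually cyclic" are synonyms; finite groups are elementary.\<close>

definition elementary :: "('g, 'b) monoid_scheme \<Rightarrow> bool" where
  "elementary G \<longleftrightarrow>
     (\<exists>H. subgroup H G \<and> cyclic_group (G\<lparr>carrier := H\<rparr>) \<and> finite (rcosets\<^bsub>G\<^esub> H))"

definition conjugacy_class :: "('g, 'b) monoid_scheme \<Rightarrow> 'g \<Rightarrow> 'g set" where
  "conjugacy_class G h = {g \<otimes>\<^bsub>G\<^esub> h \<otimes>\<^bsub>G\<^esub> inv\<^bsub>G\<^esub> g | g. g \<in> carrier G}"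

definition centralizer :: "('g, 'b) monoid_scheme \<Rightarrow> 'g \<Rightarrow> 'g set" where
  "centralizer G h = {g \<in> carrier G. g \<otimes>\<^bsub>G\<^esub> h = h \<otimes>\<^bsub>G\<^esub> g}"

text \<open>\<open>E(h)\<close>, the greatest (for inclusion) virtually cyclic subgroup containing \<open>h\<close>. As a definite
  description it is meaningful only when such a subgroup exists, as it does for strongly
  contracting \<open>h\<close>.\<close>

definition elementary_closure :: "('g, 'b) monoid_scheme \<Rightarrow> 'g \<Rightarrow> 'g set" where
  "elementary_closure G h =
     (GREATEST K. subgroup K G \<and> h \<in> K \<and> elementary (G\<lparr>carrier := K\<rparr>))"

section \<open>Spaces with a group action\<close>

definition geodesic_path :: "(real \<Rightarrow> 'x::metric_space) \<Rightarrow> 'x \<Rightarrow> 'x \<Rightarrow> bool" where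
  "geodesic_path \<gamma> x y \<longleftrightarrow> \<gamma> 0 = x \<and> \<gamma> (dist x y) = y \<and>
     (\<forall>s\<in>{0..dist x y}. \<forall>t\<in>{0..dist x y}. dist (\<gamma> s) (\<gamma> t) = \<bar>s - t\<bar>)"

locale G_space = group_action G "UNIV :: 'x::metric_space set" \<phi>
  for G (structure) and \<phi> :: "'g \<Rightarrow> 'x::metric_space \<Rightarrow> 'x" +
  assumes proper: "compact (cball (x::'x) r)"
    and geodesic: "\<exists>\<gamma>. geodesic_path \<gamma> (x::'x) y"
    and isometric: "g \<in> carrier G \<Longrightarrow> dist (\<phi> g x) (\<phi> g y) = dist x y"
    and properly_discontinuous: "compact K \<Longrightarrow> finite {g \<in> carrier G. \<phi> g ` K \<inter> K \<noteq> {}}"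

text \<open>The exponent \<open>\<delta>\<^sub>B\<close> takes values in the extended reals: it may be infinite even
  for finitely generated \<open>G\<close>. The logarithm of \<open>0\<close> is minus infinity. The balls
  counted here are finite in every \<open>G\<close>-space by the lemma below, so \<^const>\<open>card\<close> is
  the true cardinality.\<close>

definition log_count :: "nat \<Rightarrow> ereal" where
  "log_count n = (if n = 0 then - \<infinity> else ereal (ln (real n)))"

definition growth_exponent :: "('g \<Rightarrow> 'x::metric_space \<Rightarrow> 'x) \<Rightarrow> 'x \<Rightarrow> 'g set \<Rightarrow> ereal" where
  "growth_exponent \<phi> p B =
     Limsup at_top (\<lambda>r::real. ereal (1 / r) * log_count (card {g \<in> B. dist p (\<phi> g p) \<le> r}))"

lemma (in G_space) finite_orbit_ball:
  assumes "B \<subseteq> carrier G"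
  shows "finite {g \<in> B. dist p (\<phi> g p) \<le> r}"
proof (rule finite_subset[OF _ properly_discontinuous[OF proper[of p r]]])
  show "{g \<in> B. dist p (\<phi> g p) \<le> r} \<subseteq> {g \<in> carrier G. \<phi> g ` cball p r \<inter> cball p r \<noteq> {}}"
  proof
    fix g assume g: "g \<in> {g \<in> B. dist p (\<phi> g p) \<le> r}"
    have "0 \<le> r" using g order_trans[OF zero_le_dist] by blast
    hence "\<phi> g p \<in> \<phi> g ` cball p r \<inter> cball p r" using g by auto
    thus "g \<in> {g \<in> carrier G. \<phi> g ` cball p r \<inter> cball p r \<noteq> {}}" using g assms by blast
  qed
qed

text \<open>Diameter of the quotient \<open>Z \ H\<close> in the quotient pseudo-metric, in which the distance of two
  orbits is the infimum of the distances of their points.\<close>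

definition quotient_diameter :: "('g \<Rightarrow> 'x::metric_space \<Rightarrow> 'x) \<Rightarrow> 'g set \<Rightarrow> 'x set \<Rightarrow> ereal" where
  "quotient_diameter \<phi> Z H =
     (SUP x\<in>H. SUP y\<in>H. ereal (setdist ((\<lambda>z. \<phi> z x) ` Z) ((\<lambda>z. \<phi> z y) ` Z)))"

section \<open>Coarse maps\<close>

text \<open>Boundedness is required because \<^const>\<open>diameter\<close> is unspecified on unbounded sets.\<close>

definition coarse_map :: "real \<Rightarrow> 'x::metric_space set \<Rightarrow> ('x \<Rightarrow> 'x set) \<Rightarrow> bool" where
  "coarse_map C A \<pi> \<longleftrightarrow>
     (\<forall>x. \<pi> x \<noteq> {} \<and> \<pi> x \<subseteq> A \<and> bounded (\<pi> x) \<and> diameter (\<pi> x) \<le> C)"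

definition closed_nbhd :: "real \<Rightarrow> 'x::metric_space set \<Rightarrow> 'x set" where
  "closed_nbhd C S = {x. infdist x S \<le> C}"

definition coarsely_fixes :: "real \<Rightarrow> 'x::metric_space set \<Rightarrow> ('x \<Rightarrow> 'x set) \<Rightarrow> bool" where
  "coarsely_fixes C A \<pi> \<longleftrightarrow>
     (\<forall>a\<in>A. \<pi> a \<subseteq> closed_nbhd C {a} \<and> {a} \<subseteq> closed_nbhd C (\<pi> a))"

definition strongly_contracting_map :: "'x::metric_space set \<Rightarrow> ('x \<Rightarrow> 'x set) \<Rightarrow> bool" where
  "strongly_contracting_map A \<pi> \<longleftrightarrow> (\<exists>C'\<ge>0. coarse_map C' A \<pi>) \<and>
     (\<exists>C\<ge>0. coarsely_fixes C A \<pi> \<and>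
        (\<forall>x0 x1. dist x0 x1 < infdist x0 A - C \<longrightarrow> diameter (\<pi> x0 \<union> \<pi> x1) \<le> C) \<and>
        (\<forall>x. infdist x (\<pi> x) - infdist x A \<le> C))"

text \<open>The parameter \<open>1\<close> of "\<open>(1, C)\<close>-strongly constricting" says that the paths tested are
  geodesics.\<close>

definition strongly_constricting_map ::
    "real \<Rightarrow> 'x::metric_space set \<Rightarrow> ('x \<Rightarrow> 'x set) \<Rightarrow> bool" where
  "strongly_constricting_map C A \<pi> \<longleftrightarrow> (\<exists>C'\<ge>0. coarse_map C' A \<pi>) \<and>
     coarsely_fixes C A \<pi> \<and>
     (\<forall>x0 x1 \<gamma>. geodesic_path \<gamma> x0 x1 \<and> diameter (\<pi> x0 \<union> \<pi> x1) > C \<longrightarrow>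
        setdist (\<pi> x0) (\<gamma> ` {0..dist x0 x1}) \<le> C \<and>
        setdist (\<pi> x1) (\<gamma> ` {0..dist x0 x1}) \<le> C)"

definition equivariant_map ::
    "('g \<Rightarrow> 'x \<Rightarrow> 'x) \<Rightarrow> 'g set \<Rightarrow> ('x \<Rightarrow> 'x set) \<Rightarrow> bool" where
  "equivariant_map \<phi> K \<pi> \<longleftrightarrow> (\<forall>g\<in>K. \<forall>x. \<pi> (\<phi> g x) = \<phi> g ` \<pi> x)"

section \<open>Strongly contracting elements\<close>

definition quasi_geodesic :: "(int \<Rightarrow> 'x::metric_space) \<Rightarrow> bool" where
  "quasi_geodesic c \<longleftrightarrow> (\<exists>K\<ge>1. \<exists>L\<ge>0. \<forall>i j.
     real_of_int \<bar>i - j\<bar> / K - L \<le> dist (c i) (c j) \<and>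
     dist (c i) (c j) \<le> K * real_of_int \<bar>i - j\<bar> + L)"

definition acts_cocompactly :: "('g \<Rightarrow> 'x::metric_space \<Rightarrow> 'x) \<Rightarrow> 'g set \<Rightarrow> 'x set \<Rightarrow> bool" where
  "acts_cocompactly \<phi> K A \<longleftrightarrow>
     (\<forall>g\<in>K. \<phi> g ` A \<subseteq> A) \<and> (\<exists>Q. compact Q \<and> Q \<subseteq> A \<and> A = (\<Union>g\<in>K. \<phi> g ` Q))"

definition strongly_contracting_element ::
    "('g, 'b) monoid_scheme \<Rightarrow> ('g \<Rightarrow> 'x::metric_space \<Rightarrow> 'x) \<Rightarrow> 'x \<Rightarrow> 'g \<Rightarrow> bool" where
  "strongly_contracting_element G \<phi> p h \<longleftrightarrow> h \<in> carrier G \<and>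
     quasi_geodesic (\<lambda>i::int. \<phi> (h [^]\<^bsub>G\<^esub> i) p) \<and>
     (\<exists>A \<pi>. acts_cocompactly \<phi> (generate G {h}) A \<and> strongly_contracting_map A \<pi>)"

definition quasi_axis ::
    "('g, 'b) monoid_scheme \<Rightarrow> ('g \<Rightarrow> 'x::metric_space \<Rightarrow> 'x) \<Rightarrow> 'x \<Rightarrow> 'g \<Rightarrow> 'x set" where
  "quasi_axis G \<phi> p h = (\<lambda>g. \<phi> g p) ` elementary_closure G h"

end

theory Submission
  imports Defs "HOL-Real_Asymp.Real_Asymp"
begin

text \<open>Lower bound: \<open>g \<mapsto> g h g\<^sup>-\<^sup>1\<close> sends the ball of radius \<open>r\<close> of \<open>G\<close> into the ball of radius
  \<open>2 r + d(p, h p)\<close> of \<open>[h]\<close>, and two elements of a fibre differ by an element of \<open>Z(h)\<close> of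
  length at most \<open>2 r\<close>. It remains to see that \<open>Z(h)\<close> grows linearly. More generally let
  \<open>g h\<^sup>m = h\<^sup>n g\<close> with \<open>m, n \<noteq> 0\<close>. Then the \<open>g\<close>-translate of \<open>\<langle>h\<rangle> p\<close> stays at bounded distance from
  the contracting set \<open>A\<close>; as quasi-geodesics cannot make long excursions away from \<open>A\<close>, the bound
  does not depend on \<open>g\<close>. So all such \<open>g\<close> lie in finitely many cosets of \<open>\<langle>h\<rangle>\<close>, which also
  shows that they form the group \<open>E(h)\<close>.

  Upper bound: choose \<open>g\<close> in its coset \<open>g Z(h)\<close> such that the projection of \<open>g\<^sup>-\<^sup>1 p\<close> is near \<open>p\<close>.
  As \<open>h\<close> moves \<open>p\<close> far, a geodesic from \<open>g\<^sup>-\<^sup>1 p\<close> to \<open>h g\<^sup>-\<^sup>1 p\<close> passes near \<open>p\<close>, so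
  \<open>d(p, g h g\<^sup>-\<^sup>1 p)\<close> is \<open>2 d(p, g p)\<close> up to an additive constant, and each conjugate of length \<open>r\<close>
  has a conjugator of length \<open>r / 2\<close> up to a constant.\<close>

section \<open>Comparison of growth exponents\<close>

text \<open>After logarithms and division by \<open>r\<close>, the linear factor and the shift
  \<open>b\<close> vanish in the limit and only the dilation \<open>a\<close> survives. Coarse
  comparisons of balls thus become comparisons of exponents.\<close>

lemma growth_exponent_le:
  fixes a b \<alpha> \<beta> :: real
  assumes a: "a > 0" and \<alpha>: "\<alpha> > 0"
    and card_le: "\<And>r. r \<ge> 0 \<Longrightarrow>
      real (card {g \<in> B1. dist p (\<phi> g p) \<le> r}) \<le>
        (\<alpha> * r + \<beta>) * real (card {g \<in> B2. dist p (\<phi> g p) \<le> a * r + b})"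
  shows "growth_exponent \<phi> p B1 \<le> ereal a * growth_exponent \<phi> p B2"
proof (rule ccontr)
  define n1 n2 where "n1 r = card {g \<in> B1. dist p (\<phi> g p) \<le> r}"
    and "n2 r = card {g \<in> B2. dist p (\<phi> g p) \<le> r}" for r
  assume "\<not> ?thesis"
  then obtain e where e: "ereal a * growth_exponent \<phi> p B2 < ereal e"
      "ereal e < growth_exponent \<phi> p B1"
    using ereal_dense2 by (metis not_le)
  \<comment> \<open>A real rate strictly above the exponent of \<open>B2\<close>. Balls of radius
    \<open>a * r + b\<close> then yield the rate \<open>c * a = e\<close> for \<open>B1\<close>,
    which contradicts the choice of \<open>e\<close>.\<close>
  define c where "c = e / a"
  have "growth_exponent \<phi> p B2 < ereal c"
    using e(1) a unfolding c_def
    by (cases "growth_exponent \<phi> p B2") (auto simp: field_simps split: if_splits)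
  then have "\<forall>\<^sub>F R in at_top. ereal (1 / R) * log_count (n2 R) < ereal c"
    unfolding growth_exponent_def n2_def by (rule Limsup_lessD)
  then have "\<forall>\<^sub>F R in at_top. real (n2 R) \<le> exp (c * R)"
    using eventually_gt_at_top[of 0]
  proof eventually_elim
    case (elim R)
    show ?case
    proof (cases "n2 R = 0")
      case False
      then have "ln (real (n2 R)) < c * R"
        using elim by (simp add: log_count_def field_simps)
      then show ?thesis
        using False by (metis exp_le_cancel_iff exp_ln less_imp_le of_nat_0_less_iff neq0_conv)
    qed simp
  qed
  moreover have "filterlim (\<lambda>r. a * r + b) at_top at_top"
    using a by real_asymp
  ultimately have ev: "\<forall>\<^sub>F r in at_top. real (n2 (a * r + b)) \<le> exp (c * (a * r + b))"
    by (rule eventually_compose_filterlim)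
  define f where "f r = (ln (\<alpha> * r + \<beta>) + c * (a * r + b)) / r" for r
  have "\<forall>\<^sub>F r in at_top. \<alpha> * r + \<beta> > 0"
    using \<alpha> by real_asymp
  with ev have "\<forall>\<^sub>F r in at_top. ereal (1 / r) * log_count (n1 r) \<le> ereal (f r)"
    using eventually_gt_at_top[of 0]
  proof eventually_elim
    case (elim r)
    show ?case
    \<comment> \<open>For an empty ball \<open>log_count\<close> is minus infinity, and the bound is
      trivial because \<open>r > 0\<close>.\<close>
    proof (cases "n1 r = 0")
      case False
      have "real (n1 r) \<le> (\<alpha> * r + \<beta>) * real (n2 (a * r + b))"
        using card_le[of r] elim by (simp add: n1_def n2_def)
      also have "\<dots> \<le> (\<alpha> * r + \<beta>) * exp (c * (a * r + b))"
        using elim by (intro mult_left_mono) auto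
      finally have "ln (real (n1 r)) \<le> ln ((\<alpha> * r + \<beta>) * exp (c * (a * r + b)))"
        using False by (intro ln_mono) auto
      also have "\<dots> = ln (\<alpha> * r + \<beta>) + c * (a * r + b)"
        using elim by (simp add: ln_mult)
      finally show ?thesis
        using elim False by (simp add: log_count_def f_def field_simps)
    qed (use elim in \<open>simp add: log_count_def\<close>)
  qed
  then have "growth_exponent \<phi> p B1 \<le> Limsup at_top (\<lambda>r. ereal (f r))"
    unfolding growth_exponent_def n1_def by (rule Limsup_mono)
  also have "((\<lambda>r. f r) \<longlongrightarrow> c * a) at_top"
    unfolding f_def using \<alpha> by real_asymp
  then have "Limsup at_top (\<lambda>r. ereal (f r)) = ereal (c * a)"
    by (intro lim_imp_Limsup) auto
  also have "c * a = e"
    using a by (simp add: c_def)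
  finally show False
    using e(2) by simp
qed

section \<open>Paths near a strongly contracting set\<close>

lemma infdist_ltE:
  assumes "infdist x S < d" "S \<noteq> {}"
  shows "\<exists>y\<in>S. dist x y < d"
  using assms setdist_ltE[of "{x}" S d] by (metis infdist_eq_setdist insert_not_empty singletonD)

text \<open>The intended \<open>u\<close> is a translate of the orbit of \<open>h\<close>, sampled
  sparsely enough to reach the speed \<open>C + 1\<close>. The constants \<open>s\<close>,
  \<open>C\<close>, \<open>L\<close> are the same for all translates, so bounds in terms of them are
  uniform.\<close>

locale contracted_path =
  fixes u :: "int \<Rightarrow> 'x::metric_space" and A :: "'x set" and \<pi> :: "'x \<Rightarrow> 'x set" and s C L :: real
  assumes proj_nonempty: "\<pi> x \<noteq> {}"
    and proj_bounded: "bounded (\<pi> x)"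
    and contracting: "dist x y < infdist x A - C \<Longrightarrow> diameter (\<pi> x \<union> \<pi> y) \<le> C"
    and proj_near: "infdist x (\<pi> x) - infdist x A \<le> C"
    and step: "dist (u i) (u (i + 1)) \<le> s"
    and lower: "(C + 1) * real_of_int \<bar>i - j\<bar> - L \<le> dist (u i) (u j)"
    and C_nonneg: "C \<ge> 0"
begin

lemma step_nonneg: "s \<ge> 0"
  using step zero_le_dist order_trans by blast

text \<open>Along an excursion away from \<open>A\<close> each step moves the projection by at most \<open>C\<close>, whereas
  the path itself progresses at speed at least \<open>C + 1\<close>.\<close>

lemma excursion_length:
  assumes far: "\<And>i. j \<le> i \<Longrightarrow> i < j + int n \<Longrightarrow> s + C < infdist (u i) A"
  shows "real n \<le> L + infdist (u j) A + infdist (u (j + int n)) A + 2 * C + 2"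
proof -
  \<comment> \<open>The infimum need not be attained, so each \<open>q i\<close> costs an extra 1.
    Only the two end points of the excursion enter the final estimate, whence the
    \<open>+ 2\<close>.\<close>
  have "\<exists>q\<in>\<pi> (u i). dist (u i) q < infdist (u i) A + C + 1" for i
  proof -
    have "infdist (u i) (\<pi> (u i)) < infdist (u i) A + C + 1"
      using proj_near[of "u i"] by simp
    then show ?thesis
      using proj_nonempty by (intro infdist_ltE)
  qed
  then obtain q where q: "\<And>i. q i \<in> \<pi> (u i)"
      "\<And>i. dist (u i) (q i) < infdist (u i) A + C + 1"
    by metis
  have "dist (q j) (q (j + int l)) \<le> C * real l" if "l \<le> n" for l
    using that
  proof (induction l)
    case (Suc l)
    let ?i = "j + int l"
    have "dist (u ?i) (u (?i + 1)) < infdist (u ?i) A - C"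
      using step[of ?i] far[of ?i] Suc.prems by simp
    then have "diameter (\<pi> (u ?i) \<union> \<pi> (u (?i + 1))) \<le> C"
      by (rule contracting)
    moreover have "dist (q ?i) (q (?i + 1)) \<le> diameter (\<pi> (u ?i) \<union> \<pi> (u (?i + 1)))"
      using q(1) by (intro diameter_bounded_bound) (auto simp: proj_bounded)
    ultimately have "dist (q ?i) (q (?i + 1)) \<le> C" by simp
    moreover have "dist (q j) (q ?i) \<le> C * real l"
      using Suc by simp
    moreover have "dist (q j) (q (?i + 1)) \<le> dist (q j) (q ?i) + dist (q ?i) (q (?i + 1))"
      by (rule dist_triangle)
    ultimately show ?case
      by (simp add: algebra_simps)
  qed simp
  then have "dist (q j) (q (j + int n)) \<le> C * real n"
    by blast
  moreover have "dist (u j) (u (j + int n)) \<le>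
      dist (u j) (q j) + dist (q j) (q (j + int n)) + dist (u (j + int n)) (q (j + int n))"
    using dist_triangle[of "u j" "u (j + int n)" "q j"]
      dist_triangle[of "q j" "u (j + int n)" "q (j + int n)"]
    by (simp add: dist_commute)
  moreover have "(C + 1) * real n - L \<le> dist (u j) (u (j + int n))"
    using lower[of j "j + int n"] by simp
  ultimately show ?thesis
    using q(2)[of j] q(2)[of "j + int n"] by (simp add: algebra_simps)
qed

lemma infdist_step: "infdist (u (i + 1)) A \<le> infdist (u i) A + s"
  using infdist_triangle[of "u (i + 1)" A "u i"] step[of i] by (simp add: dist_commute)

lemma infdist_steps: "infdist (u (i + int n)) A \<le> infdist (u i) A + s * real n"
proof (induction n)
  case (Suc n)
  then show ?case
    using infdist_step[of "i + int n"] by (simp add: algebra_simps)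
qed simp

text \<open>The a priori bound \<open>M\<close> makes excursions end, and then \<open>excursion_length\<close> bounds them
  independently of \<open>M\<close>.\<close>

lemma infdist_uniformly_bounded:
  assumes M: "\<And>i. infdist (u i) A \<le> M"
  shows "infdist (u i) A \<le> s + C + s * (L + 3 * s + 4 * C + 2)"
proof (cases "infdist (u i) A \<le> s + C")
  case True
  \<comment> \<open>The diagonal case of \<open>lower\<close> gives \<open>L \<ge> 0\<close>, so the
    second half of the bound is nonnegative.\<close>
  have "0 - L \<le> 0"
    using lower[of 0 0] by simp
  then have "0 \<le> s * (L + 3 * s + 4 * C + 2)"
    using step_nonneg C_nonneg by simp
  with True show ?thesis by simp
next
  case far_i: False
  \<comment> \<open>By \<open>excursion_length\<close> and the a priori bound, \<open>N\<close>
    consecutive points cannot all be far from \<open>A\<close>. Hence the path comes near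
    \<open>A\<close> both after and before \<open>i\<close>.\<close>
  obtain N :: nat where N: "L + M + M + 2 * C + 2 < real N"
    using reals_Archimedean2 by blast
  have ex: "\<exists>k<N. infdist (u (j + int k)) A \<le> s + C" for j
  proof (rule ccontr)
    assume *: "\<not> ?thesis"
    have "s + C < infdist (u l) A" if "j \<le> l" "l < j + int N" for l
    proof -
      have "l = j + int (nat (l - j))" "nat (l - j) < N"
        using that by auto
      then show ?thesis
        using * by (metis not_le)
    qed
    then have "real N \<le> L + infdist (u j) A + infdist (u (j + int N)) A + 2 * C + 2"
      by (rule excursion_length)
    then show False
      using N M[of j] M[of "j + int N"] by simp
  qed
  \<comment> \<open>\<open>i + b\<close> is the first near index from \<open>i\<close> on,
    \<open>i - a\<close> the last one up to \<open>i\<close>. Both \<open>a\<close> and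
    \<open>b\<close> are positive because \<open>u i\<close> itself is far.\<close>
  define P where "P k \<longleftrightarrow> infdist (u (i + int k)) A \<le> s + C" for k
  define Q where "Q k \<longleftrightarrow> infdist (u (i - int k)) A \<le> s + C" for k
  define b where "b = (LEAST k. P k)"
  define a where "a = (LEAST k. Q k)"
  have "\<exists>k. P k"
    using ex[of i] by (auto simp: P_def)
  then have b: "P b" "\<And>k. k < b \<Longrightarrow> \<not> P k"
    unfolding b_def by (auto intro: LeastI dest: not_less_Least)
  have "\<exists>k. Q k"
  proof -
    obtain k where "k < N" "infdist (u (i - int N + int k)) A \<le> s + C"
      using ex by blast
    then have "Q (N - k)"
      by (simp add: Q_def of_nat_diff algebra_simps)
    then show ?thesis ..
  qed
  then have a: "Q a" "\<And>k. k < a \<Longrightarrow> \<not> Q k"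
    unfolding a_def by (auto intro: LeastI dest: not_less_Least)
  have "a > 0"
    using a(1) far_i by (cases a) (auto simp: Q_def)
  \<comment> \<open>Starting one index after the last near point makes every index of the excursion
    far. The end distances are then at most \<open>2 * s + C\<close> and \<open>s + C\<close>, which
    gives \<open>L + 3 * s + 4 * C + 2\<close>.\<close>
  let ?j = "i - int a + 1"
  have "s + C < infdist (u l) A" if "?j \<le> l" "l < ?j + int (a + b - 1)" for l
  proof (cases "l \<ge> i")
    case True
    with that \<open>a > 0\<close> have "l = i + int (nat (l - i))" "nat (l - i) < b" by auto
    then show ?thesis
      using b(2) unfolding P_def by (metis not_le)
  next
    case False
    with that have "l = i - int (nat (i - l))" "nat (i - l) < a" by auto
    then show ?thesis
      using a(2) unfolding Q_def by (metis not_le)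
  qed
  then have "real (a + b - 1) \<le>
      L + infdist (u ?j) A + infdist (u (?j + int (a + b - 1))) A + 2 * C + 2"
    by (rule excursion_length)
  moreover have "?j + int (a + b - 1) = i + int b"
    using \<open>a > 0\<close> by simp
  moreover have "infdist (u ?j) A \<le> s + C + s"
    using infdist_step[of "i - int a"] a(1) by (simp add: Q_def)
  moreover have "b > 0"
    using b(1) far_i by (cases b) (auto simp: P_def)
  ultimately have "real a \<le> L + 3 * s + 4 * C + 2"
    using b(1) \<open>a > 0\<close> by (simp add: P_def of_nat_diff)
  then have "s * real a \<le> s * (L + 3 * s + 4 * C + 2)"
    using step_nonneg by (rule mult_left_mono)
  \<comment> \<open>From the near point \<open>u (i - a)\<close> the path needs only
    \<open>a\<close> steps to reach \<open>u i\<close>.\<close>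
  moreover have "infdist (u i) A \<le> infdist (u (i - int a)) A + s * real a"
    using infdist_steps[of "i - int a" a] by simp
  ultimately show ?thesis
    using a(1) by (simp add: Q_def)
qed

end

section \<open>Elements commensurating a cyclic subgroup\<close>

text \<open>If \<open>h\<close> has infinite order, the condition says that the cyclic group of
  \<open>h\<close> and its conjugate by \<open>g\<close> share a nontrivial element, so this is the
  commensurator of that group. Relations with \<open>g\<close> on both sides compose more easily
  than conjugates.\<close>

definition commensurator :: "('g, 'b) monoid_scheme \<Rightarrow> 'g \<Rightarrow> 'g set" where
  "commensurator G h = {g \<in> carrier G. \<exists>(m::int) (n::int). m \<noteq> 0 \<and> n \<noteq> 0 \<and>
     g \<otimes>\<^bsub>G\<^esub> h [^]\<^bsub>G\<^esub> m = h [^]\<^bsub>G\<^esub> n \<otimes>\<^bsub>G\<^esub> g}"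

lemma commensuratorI:
  fixes m n :: int
  assumes "g \<otimes>\<^bsub>G\<^esub> h [^]\<^bsub>G\<^esub> m = h [^]\<^bsub>G\<^esub> n \<otimes>\<^bsub>G\<^esub> g" "m \<noteq> 0" "n \<noteq> 0" "g \<in> carrier G"
  shows "g \<in> commensurator G h"
  using assms unfolding commensurator_def by blast

context group
begin

section \<open>Intertwining relations, centralizers and virtually cyclic subgroups\<close>

lemma intertwine_inv:
  assumes "g \<otimes> a = b \<otimes> g" and [simp]: "g \<in> carrier G" "a \<in> carrier G" "b \<in> carrier G"
  shows "g \<otimes> inv a = inv b \<otimes> g" "a \<otimes> inv g = inv g \<otimes> b"
proof -
  have "b = (b \<otimes> g) \<otimes> inv g"
    by (simp add: m_assoc)
  also have "\<dots> = g \<otimes> a \<otimes> inv g"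
    by (simp add: assms(1))
  finally have b: "b = g \<otimes> a \<otimes> inv g" .
  show "g \<otimes> inv a = inv b \<otimes> g"
    unfolding b by (simp add: inv_mult_group m_assoc)
  show "a \<otimes> inv g = inv g \<otimes> b"
    unfolding b by (simp add: m_assoc[symmetric])
qed

lemma intertwine_int_pow:
  assumes eq: "g \<otimes> a = b \<otimes> g" and [simp]: "g \<in> carrier G" "a \<in> carrier G" "b \<in> carrier G"
  shows "g \<otimes> a [^] (k::int) = b [^] k \<otimes> g"
proof -
  have nat: "g \<otimes> a [^] (n::nat) = b [^] n \<otimes> g" for n
  proof (induction n)
    case (Suc n)
    have "g \<otimes> a [^] Suc n = (g \<otimes> a [^] n) \<otimes> a"
      by (simp add: m_assoc)
    also have "\<dots> = b [^] n \<otimes> (g \<otimes> a)"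
      by (simp add: Suc m_assoc)
    also have "\<dots> = b [^] Suc n \<otimes> g"
      by (simp add: eq m_assoc)
    finally show ?case .
  qed simp
  show ?thesis
  proof (cases "k < 0")
    case True
    show ?thesis
      unfolding int_pow_def2 if_P[OF True] by (rule intertwine_inv(1)[OF nat]) simp_all
  next
    case False
    show ?thesis
      unfolding int_pow_def2 if_not_P[OF False] by (rule nat)
  qed
qed

lemma subgroup_commensurator:
  assumes [simp]: "h \<in> carrier G"
  shows "subgroup (commensurator G h) G"
proof (rule subgroupI)
  show "commensurator G h \<subseteq> carrier G"
    by (auto simp: commensurator_def)
  have "\<one> \<in> commensurator G h"
    unfolding commensurator_def by (auto intro!: exI[of _ 1])
  then show "commensurator G h \<noteq> {}"
    by blast
next
  fix g assume g: "g \<in> commensurator G h"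
  then obtain m n :: int where [simp]: "g \<in> carrier G" and mn: "m \<noteq> 0" "n \<noteq> 0"
      and eq: "g \<otimes> h [^] m = h [^] n \<otimes> g"
    by (auto simp: commensurator_def)
  have "inv g \<otimes> h [^] n = h [^] m \<otimes> inv g"
    using intertwine_inv(2)[OF eq] by simp
  with mn show "inv g \<in> commensurator G h"
    by (auto simp: commensurator_def)
next
  fix g1 g2 assume "g1 \<in> commensurator G h" "g2 \<in> commensurator G h"
  then obtain m1 n1 m2 n2 :: int where [simp]: "g1 \<in> carrier G" "g2 \<in> carrier G"
      and nz: "m1 \<noteq> 0" "n1 \<noteq> 0" "m2 \<noteq> 0" "n2 \<noteq> 0"
      and eq: "g1 \<otimes> h [^] m1 = h [^] n1 \<otimes> g1" "g2 \<otimes> h [^] m2 = h [^] n2 \<otimes> g2"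
    by (auto simp: commensurator_def)
  \<comment> \<open>Raising the relations to the powers \<open>n2\<close> and \<open>m1\<close>
    makes the exponent that comes out of \<open>g2\<close> equal to the one that goes into
    \<open>g1\<close>.\<close>
  have "g1 \<otimes> h [^] (m1 * n2) = h [^] (n1 * n2) \<otimes> g1"
    using intertwine_int_pow[OF eq(1), of n2] by (simp add: int_pow_pow)
  moreover have "g2 \<otimes> h [^] (m2 * m1) = h [^] (n2 * m1) \<otimes> g2"
    using intertwine_int_pow[OF eq(2), of m1] by (simp add: int_pow_pow)
  ultimately have "g1 \<otimes> g2 \<otimes> h [^] (m2 * m1) = h [^] (n1 * n2) \<otimes> (g1 \<otimes> g2)"
    by (metis (no_types, lifting) \<open>g1 \<in> carrier G\<close> \<open>g2 \<in> carrier G\<close> assms int_pow_closed m_assoc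
        mult.commute)
  then show "g1 \<otimes> g2 \<in> commensurator G h"
    by (rule commensuratorI) (use nz in auto)
qed

lemma centralizer_subset_commensurator:
  assumes "h \<in> carrier G"
  shows "centralizer G h \<subseteq> commensurator G h"
proof
  fix g assume "g \<in> centralizer G h"
  then show "g \<in> commensurator G h"
    using assms by (intro commensuratorI[of _ _ _ 1 1]) (simp_all add: centralizer_def)
qed

lemma subgroup_centralizer:
  assumes [simp]: "h \<in> carrier G"
  shows "subgroup (centralizer G h) G"
proof (rule subgroupI)
  show "centralizer G h \<subseteq> carrier G"
    by (auto simp: centralizer_def)
  have "\<one> \<in> centralizer G h"
    by (auto simp: centralizer_def)
  then show "centralizer G h \<noteq> {}"
    by blast
next
  fix g assume "g \<in> centralizer G h"
  then show "inv g \<in> centralizer G h"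
    using intertwine_inv(2)[of g h h] by (auto simp: centralizer_def)
next
  fix g1 g2 assume "g1 \<in> centralizer G h" "g2 \<in> centralizer G h"
  then have [simp]: "g1 \<in> carrier G" "g2 \<in> carrier G"
      and eq: "g1 \<otimes> h = h \<otimes> g1" "g2 \<otimes> h = h \<otimes> g2"
    by (auto simp: centralizer_def)
  have "g1 \<otimes> g2 \<otimes> h = (g1 \<otimes> h) \<otimes> g2"
    by (simp add: m_assoc eq(2))
  also have "\<dots> = h \<otimes> (g1 \<otimes> g2)"
    by (simp add: eq(1) m_assoc)
  finally show "g1 \<otimes> g2 \<in> centralizer G h"
    by (simp add: centralizer_def)
qed

lemma conjugation_eq_imp_centralizer:
  assumes "g \<otimes> h \<otimes> inv g = g' \<otimes> h \<otimes> inv g'"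
    and [simp]: "g \<in> carrier G" "g' \<in> carrier G" "h \<in> carrier G"
  shows "inv g' \<otimes> g \<in> centralizer G h"
proof -
  have "inv g' \<otimes> (g \<otimes> h \<otimes> inv g) \<otimes> g = inv g' \<otimes> (g' \<otimes> h \<otimes> inv g') \<otimes> g"
    by (simp only: assms(1))
  then have "inv g' \<otimes> g \<otimes> h = h \<otimes> (inv g' \<otimes> g)"
    by (simp add: m_assoc inv_solve_left')
  then show ?thesis
    by (simp add: centralizer_def)
qed

text \<open>Pigeonhole: two different powers of \<open>x\<close> lie in the same coset, and their
  quotient lies in \<open>H\<close>.\<close>

lemma finite_index_pow:
  assumes H: "subgroup H G" and fin: "finite (rcosets H)" and x[simp]: "x \<in> carrier G"
  shows "\<exists>n::int. n \<noteq> 0 \<and> x [^] n \<in> H"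
proof -
  have "range (\<lambda>n::int. H #> x [^] n) \<subseteq> rcosets H"
    using H by (auto simp: subgroup.subset rcosetsI)
  then have "finite (range (\<lambda>n::int. H #> x [^] n))"
    using fin finite_subset by blast
  then have "\<not> inj (\<lambda>n::int. H #> x [^] n)"
    using finite_imageD infinite_UNIV_int by blast
  then obtain m n :: int where mn: "m \<noteq> n" "H #> x [^] m = H #> x [^] n"
    by (auto simp: inj_on_def)
  have "x [^] m \<in> H #> x [^] n"
    using mn(2) H by (metis int_pow_closed rcos_self x)
  then obtain k where k: "k \<in> H" "x [^] m = k \<otimes> x [^] n"
    by (auto simp: r_coset_def)
  have "k \<in> carrier G"
    using H k(1) by (rule subgroup.mem_carrier)
  with k(2) have "x [^] (m - n) = k"
    by (simp add: int_pow_diff m_assoc)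
  with k(1) mn(1) show ?thesis
    by (intro exI[of _ "m - n"]) auto
qed

text \<open>Both \<open>h\<close> and its conjugate by \<open>k\<close> have nonzero powers in a
  cyclic group generated by some \<open>c\<close>. Any two nontrivial powers of \<open>c\<close>
  have a common power, and the infinite order of \<open>h\<close> keeps all exponents
  nonzero.\<close>

lemma elementary_subset_commensurator:
  assumes K: "subgroup K G" and h: "h \<in> K" and elem: "elementary (G\<lparr>carrier := K\<rparr>)"
    and inf: "\<And>n::int. n \<noteq> 0 \<Longrightarrow> h [^] n \<noteq> \<one>"
  shows "K \<subseteq> commensurator G h"
proof
  fix k assume k: "k \<in> K"
  interpret K: group "G\<lparr>carrier := K\<rparr>"
    using K by (rule subgroup_imp_group)
  obtain H where H: "subgroup H (G\<lparr>carrier := K\<rparr>)" "cyclic_group (G\<lparr>carrier := H\<rparr>)"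
      "finite (rcosets\<^bsub>G\<lparr>carrier := K\<rparr>\<^esub> H)"
    using elem by (auto simp: elementary_def)
  have HG: "subgroup H G"
    using incl_subgroup[OF K H(1)] .
  interpret H: group "G\<lparr>carrier := H\<rparr>"
    using HG by (rule subgroup_imp_group)
  obtain c where c: "c \<in> H" "H = range (\<lambda>n::int. c [^]\<^bsub>G\<lparr>carrier := H\<rparr>\<^esub> n)"
    using H(2) by (auto simp: H.cyclic_group)
  then have H_eq: "H = range (\<lambda>n::int. c [^] n)"
    using int_pow_consistent[OF HG c(1)] by simp
  have [simp]: "c \<in> carrier G" "k \<in> carrier G" "h \<in> carrier G"
    using HG K c(1) k h by (auto dest: subgroup.mem_carrier)
  have pow: "\<exists>(n::int) (m::int). n \<noteq> 0 \<and> x [^] n = c [^] m" if x: "x \<in> K" for x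
    using K.finite_index_pow[OF H(1,3), of x] x int_pow_consistent[OF K x] H_eq by auto
  obtain a b :: int where ab: "a \<noteq> 0" "h [^] a = c [^] b"
    using pow[OF h] by blast
  let ?x = "k \<otimes> h \<otimes> inv k"
  have "?x \<in> K"
    using K k h by (simp add: subgroup.m_closed subgroup.m_inv_closed)
  then obtain a' b' :: int where ab': "a' \<noteq> 0" "?x [^] a' = c [^] b'"
    using pow by blast
  have "k \<otimes> h = ?x \<otimes> k"
    by (simp add: m_assoc)
  then have eq: "k \<otimes> h [^] a' = c [^] b' \<otimes> k"
    using intertwine_int_pow[of k h ?x a'] ab'(2) by simp
  have "b \<noteq> 0"
    using ab inf by fastforce
  have "b' \<noteq> 0"
  proof
    assume "b' = 0"
    then have "h [^] a' = \<one>"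
      using eq by simp
    then show False
      using inf ab'(1) by blast
  qed
  have "k \<otimes> h [^] (a' * b) = c [^] (b' * b) \<otimes> k"
    using intertwine_int_pow[OF eq, of b] by (simp add: int_pow_pow)
  also have "c [^] (b' * b) = h [^] (a * b')"
    by (metis ab(2) int_pow_pow \<open>c \<in> carrier G\<close> \<open>h \<in> carrier G\<close> mult.commute)
  finally show "k \<in> commensurator G h"
    by (rule commensuratorI) (use \<open>b \<noteq> 0\<close> \<open>b' \<noteq> 0\<close> ab(1) ab'(1) in auto)
qed

text \<open>The cover says that each right coset of the cyclic group of \<open>h\<close> in
  \<open>E\<close> is the coset of some \<open>f \<in> F\<close>, so the index is finite.\<close>

lemma elementary_if_finitely_many_cosets:
  assumes E: "subgroup E G" and h: "h \<in> E" and F: "finite F" "F \<subseteq> carrier G"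
    and cover: "\<And>g. g \<in> E \<Longrightarrow> \<exists>i::int. \<exists>f\<in>F. g = h [^] i \<otimes> f"
  shows "elementary (G\<lparr>carrier := E\<rparr>)"
proof -
  let ?H = "generate G {h}"
  have hG[simp]: "h \<in> carrier G"
    using E h by (rule subgroup.mem_carrier)
  have H_eq: "?H = range (\<lambda>i::int. h [^] i)"
    by (auto simp: generate_pow)
  have H: "subgroup ?H G"
    by (simp add: generate_is_subgroup)
  have "?H \<subseteq> E"
    using subgroup_int_pow_closed[OF E h] by (auto simp: H_eq)
  then have 1: "subgroup ?H (G\<lparr>carrier := E\<rparr>)"
    using subgroup_incl[OF H E] by simp
  interpret H: group "G\<lparr>carrier := ?H\<rparr>"
    using H by (rule subgroup_imp_group)
  have "h \<in> ?H"
    by (simp add: generate.incl)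
  moreover from this have "?H = range (\<lambda>i::int. h [^]\<^bsub>G\<lparr>carrier := ?H\<rparr>\<^esub> i)"
    unfolding int_pow_consistent[OF H \<open>h \<in> ?H\<close>, symmetric] by (simp only: H_eq)
  moreover have carrier: "carrier (G\<lparr>carrier := ?H\<rparr>) = ?H"
    by simp
  ultimately have 2: "cyclic_group (G\<lparr>carrier := ?H\<rparr>)"
    unfolding H.cyclic_group carrier by blast
  have "rcosets\<^bsub>G\<lparr>carrier := E\<rparr>\<^esub> ?H \<subseteq> (\<lambda>f. ?H #> f) ` F"
  proof
    fix S assume "S \<in> rcosets\<^bsub>G\<lparr>carrier := E\<rparr>\<^esub> ?H"
    then obtain g where g: "g \<in> E" "S = ?H #> g"
      by (auto simp: RCOSETS_def r_coset_def)
    then obtain i :: int and f where f: "f \<in> F" "g = h [^] i \<otimes> f"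
      using cover by blast
    have "?H #> g = (?H #> h [^] i) #> f"
      unfolding f(2) using f(1) F(2) H by (intro coset_mult_assoc[symmetric]) (auto simp: subgroup.subset)
    also have "?H #> h [^] i = ?H"
      using H by (intro coset_join2) (auto simp: H_eq)
    finally show "S \<in> (\<lambda>f. ?H #> f) ` F"
      using g(2) f(1) by blast
  qed
  then have 3: "finite (rcosets\<^bsub>G\<lparr>carrier := E\<rparr>\<^esub> ?H)"
    using F(1) finite_surj by blast
  show ?thesis
    unfolding elementary_def using 1 2 3 by (intro exI[of _ ?H]) simp
qed

end

section \<open>Counting conjugates\<close>

lemma geodesic_path_split:
  assumes "geodesic_path \<gamma> x y" and s: "s \<in> {0..dist x y}"
  shows "dist x (\<gamma> s) + dist (\<gamma> s) y = dist x y"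
proof -
  have ends: "\<gamma> 0 = x" "\<gamma> (dist x y) = y" and
    iso: "\<And>t u. t \<in> {0..dist x y} \<Longrightarrow> u \<in> {0..dist x y} \<Longrightarrow> dist (\<gamma> t) (\<gamma> u) = \<bar>t - u\<bar>"
    using assms(1) unfolding geodesic_path_def by blast+
  show ?thesis
    using iso[of 0 s] iso[OF s, of "dist x y"] s by (simp add: ends)
qed

context G_space
begin

section \<open>Rules for the isometric action\<close>

sublocale group G
  using group_hom group_hom.axioms(1) by blast

lemma action_mult [simp]:
  "g \<in> carrier G \<Longrightarrow> g' \<in> carrier G \<Longrightarrow> \<phi> (g \<otimes> g') x = \<phi> g (\<phi> g' x)"
  by (simp add: composition_rule)

lemma action_one [simp]: "\<phi> \<one> x = x"
  using id_eq_one by (metis UNIV_I restrict_apply')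

lemma action_inv [simp]:
  "g \<in> carrier G \<Longrightarrow> \<phi> (inv g) (\<phi> g x) = x" "g \<in> carrier G \<Longrightarrow> \<phi> g (\<phi> (inv g) x) = x"
  by (simp_all flip: action_mult)

lemma dist_action_inv:
  "g \<in> carrier G \<Longrightarrow> dist (\<phi> (inv g) x) y = dist x (\<phi> g y)"
  using isometric[of g "\<phi> (inv g) x" y] by simp

lemma finite_orbit_near: "finite {g \<in> carrier G. dist p (\<phi> g p) \<le> r}"
  by (rule finite_orbit_ball) simp

lemma card_le_conjugacy_class:
  assumes h: "h \<in> carrier G"
    and Z: "real (card {g \<in> centralizer G h. dist p (\<phi> g p) \<le> 2 * r}) \<le> \<zeta>"
  shows "real (card {g \<in> carrier G. dist p (\<phi> g p) \<le> r}) \<le>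
    \<zeta> * real (card {g \<in> conjugacy_class G h. dist p (\<phi> g p) \<le> 2 * r + dist p (\<phi> h p)})"
proof -
  define B where "B = {g \<in> carrier G. dist p (\<phi> g p) \<le> r}"
  define R where "R = {g \<in> conjugacy_class G h. dist p (\<phi> g p) \<le> 2 * r + dist p (\<phi> h p)}"
  define S where "S = {g \<in> centralizer G h. dist p (\<phi> g p) \<le> 2 * r}"
  define f where "f g = g \<otimes> h \<otimes> inv g" for g
  have "finite B"
    unfolding B_def by (rule finite_orbit_near)
  have "finite R"
    unfolding R_def using h by (intro finite_orbit_ball) (auto simp: conjugacy_class_def)
  have "finite S"
    unfolding S_def by (intro finite_orbit_ball) (auto simp: centralizer_def)
  have "f g \<in> R" if "g \<in> B" for g
  proof -
    from that have g: "g \<in> carrier G" "dist p (\<phi> g p) \<le> r"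
      by (auto simp: B_def)
    let ?q = "\<phi> (inv g) p"
    have q: "dist p ?q = dist p (\<phi> g p)"
      using dist_action_inv[OF g(1), of p p] by (simp add: dist_commute)
    have "dist p (\<phi> (f g) p) = dist ?q (\<phi> h ?q)"
      using g h by (simp add: f_def dist_action_inv)
    also have "\<dots> \<le> dist p ?q + dist p (\<phi> h p) + dist (\<phi> h p) (\<phi> h ?q)"
      using dist_triangle[of ?q "\<phi> h ?q" p] dist_triangle[of p "\<phi> h ?q" "\<phi> h p"]
      by (simp add: dist_commute)
    finally have "dist p (\<phi> (f g) p) \<le> 2 * r + dist p (\<phi> h p)"
      using g(2) q isometric[OF h, of p ?q] by simp
    then show ?thesis
      using g by (auto simp: R_def f_def conjugacy_class_def)
  qed
  then have "f ` B \<subseteq> R" by blast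
  \<comment> \<open>Left translation by the inverse of one fixed \<open>g'\<close> embeds the fibre
    into the centralizer. The triangle inequality through \<open>p\<close> doubles the
    radius.\<close>
  have fibre: "card {g \<in> B. f g = k} \<le> card S" for k
  proof (cases "\<exists>g'\<in>B. f g' = k")
    case True
    then obtain g' where g': "g' \<in> B" "f g' = k" by blast
    then have [simp]: "g' \<in> carrier G" by (simp add: B_def)
    show ?thesis
    proof (rule card_inj_on_le[OF _ _ \<open>finite S\<close>])
      show "inj_on (\<lambda>g. inv g' \<otimes> g) {g \<in> B. f g = k}"
        by (auto simp: inj_on_def B_def)
      show "(\<lambda>g. inv g' \<otimes> g) ` {g \<in> B. f g = k} \<subseteq> S"
      proof safe
        fix g assume g: "g \<in> B" "k = f g"
        then have [simp]: "g \<in> carrier G" by (simp add: B_def)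
        have "inv g' \<otimes> g \<in> centralizer G h"
          using g g' h by (intro conjugation_eq_imp_centralizer) (simp_all add: f_def)
        moreover have "dist p (\<phi> (inv g' \<otimes> g) p) = dist (\<phi> g p) (\<phi> g' p)"
          by (simp add: dist_commute[of p] dist_action_inv)
        moreover have "\<dots> \<le> 2 * r"
          using g(1) g'(1) dist_triangle3[of "\<phi> g p" "\<phi> g' p" p] by (simp add: B_def)
        ultimately show "inv g' \<otimes> g \<in> S"
          by (simp add: S_def)
      qed
    qed
  next
    case False
    then have "{g \<in> B. f g = k} = {}" by blast
    then show ?thesis by (metis card.empty zero_le)
  qed
  have "card B = (\<Sum>k\<in>R. card {g \<in> B. f g = k})"
    using sum_fun_comp[OF \<open>finite B\<close> \<open>finite R\<close> \<open>f ` B \<subseteq> R\<close>, of "\<lambda>_. 1::nat"] by simp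
  also have "\<dots> \<le> card R * card S"
    using sum_bounded_above[of R _ "card S"] fibre by simp
  finally have "real (card B) \<le> real (card S) * real (card R)"
    by (metis mult.commute of_nat_le_iff of_nat_mult)
  also have "\<dots> \<le> \<zeta> * real (card R)"
    using Z by (intro mult_right_mono) (simp_all add: S_def)
  finally show ?thesis
    by (simp add: B_def R_def)
qed

text \<open>After moving the conjugator \<open>g\<close> along \<open>Z(h)\<close>, the point \<open>x = g\<^sup>-\<^sup>1 p\<close>
  projects near \<open>p\<close>, so every geodesic from \<open>x\<close> to \<open>h x\<close> passes near \<open>p\<close>.\<close>

lemma conjugator_dist:
  assumes h: "h \<in> carrier G" and Z: "centralizer G h \<subseteq> E" and hE: "h \<in> E" and pH: "p \<in> H"
    and equi: "equivariant_map \<phi> E \<pi>"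
    and constr: "strongly_constricting_map C H \<pi>" and coarse: "coarse_map C H \<pi>"
    and diam: "quotient_diameter \<phi> (centralizer G h) H < ereal D"
    and long: "dist p (\<phi> h p) > C + 2 * D"
    and k: "k \<in> conjugacy_class G h"
  shows "\<exists>g\<in>carrier G. g \<otimes> h \<otimes> inv g = k \<and>
    dist p (\<phi> g p) \<le> dist p (\<phi> k p) / 2 + (dist p (\<phi> h p) / 2 + 2 * C + D + 1)"
proof -
  obtain g0 where g0: "g0 \<in> carrier G" "k = g0 \<otimes> h \<otimes> inv g0"
    using k by (auto simp: conjugacy_class_def)
  define x0 where "x0 = \<phi> (inv g0) p"
  obtain y0 where y0: "y0 \<in> \<pi> x0" "y0 \<in> H"
    using coarse by (fastforce simp: coarse_map_def)
  \<comment> \<open>The infimum over translates lies strictly below \<open>D\<close>, so some pair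
    of translates is closer than \<open>D\<close>. Moving both by the inverse of \<open>z2\<close>
    leaves a single \<open>z\<close> in the centralizer that brings \<open>y0\<close> near
    \<open>p\<close>.\<close>
  have "ereal (setdist ((\<lambda>z. \<phi> z y0) ` centralizer G h) ((\<lambda>z. \<phi> z p) ` centralizer G h)) \<le>
      quotient_diameter \<phi> (centralizer G h) H"
    unfolding quotient_diameter_def using y0(2) pH by (intro SUP_upper2[of y0] SUP_upper2[of p]) auto
  also note diam
  finally have "setdist ((\<lambda>z. \<phi> z y0) ` centralizer G h) ((\<lambda>z. \<phi> z p) ` centralizer G h) < D"
    by simp
  moreover have "\<one> \<in> centralizer G h"
    using subgroup.one_closed[OF subgroup_centralizer[OF h]] .
  ultimately obtain z1 z2 where z12: "z1 \<in> centralizer G h" "z2 \<in> centralizer G h"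
      "dist (\<phi> z1 y0) (\<phi> z2 p) < D"
    using setdist_ltE by blast
  then have [simp]: "z1 \<in> carrier G" "z2 \<in> carrier G"
    by (auto simp: centralizer_def)
  define z where "z = inv z2 \<otimes> z1"
  have zZ: "z \<in> centralizer G h"
    using subgroup_centralizer[OF h] z12 by (simp add: z_def subgroup.m_closed subgroup.m_inv_closed)
  have [simp]: "z \<in> carrier G"
    by (simp add: z_def)
  \<comment> \<open>As \<open>z\<close> commutes with \<open>h\<close>, the conjugate
    \<open>k\<close> does not change, while the inverse of \<open>g\<close> now sends
    \<open>p\<close> to \<open>\<phi> z x0\<close>.\<close>
  define g where "g = g0 \<otimes> inv z"
  have [simp]: "g \<in> carrier G"
    using g0 by (simp add: g_def)
  have gk: "g \<otimes> h \<otimes> inv g = k"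
  proof -
    have "inv z \<otimes> h = h \<otimes> inv z"
      using intertwine_inv(2)[of z h h] zZ h by (simp add: centralizer_def)
    then have "inv z \<otimes> (h \<otimes> z) = h"
      using h by (simp add: m_assoc flip: m_assoc[of "inv z"])
    then show ?thesis
      using g0 h by (simp add: g_def inv_mult_group m_assoc) (simp flip: m_assoc)
  qed
  define x where "x = \<phi> (inv g) p"
  define y where "y = \<phi> z y0"
  have x_eq: "x = \<phi> z x0"
    using g0 by (simp add: x_def x0_def g_def inv_mult_group)
  have "\<pi> x = \<phi> z ` \<pi> x0"
    using equi Z zZ by (auto simp: equivariant_map_def x_eq)
  then have y: "y \<in> \<pi> x"
    using y0(1) by (simp add: y_def)
  have yp: "dist y p < D"
    using z12(3) by (simp add: y_def z_def dist_action_inv)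
  have hpi: "\<pi> (\<phi> h x) = \<phi> h ` \<pi> x"
    using equi hE by (simp add: equivariant_map_def)
  have bdd: "bounded (\<pi> v)" and diam_le: "diameter (\<pi> v) \<le> C" for v
    using coarse by (auto simp: coarse_map_def)
  have C: "C \<ge> 0"
    using diameter_ge_0[OF bdd] diam_le order_trans by blast
  \<comment> \<open>Replacing \<open>p\<close> by \<open>y\<close> costs less than \<open>D\<close>
    at each end, so \<open>y\<close> and \<open>\<phi> h y\<close>, which lie in the two
    projections, are still more than \<open>C\<close> apart.\<close>
  have "dist p (\<phi> h p) \<le> dist p y + dist y (\<phi> h y) + dist (\<phi> h p) (\<phi> h y)"
    using dist_triangle[of p "\<phi> h p" y] dist_triangle[of y "\<phi> h p" "\<phi> h y"]
    by (simp add: dist_commute)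
  then have "C < dist y (\<phi> h y)"
    using isometric[OF h, of p y] yp long by (simp add: dist_commute)
  also have "\<phi> h y \<in> \<pi> (\<phi> h x)"
    using y by (simp add: hpi)
  then have "dist y (\<phi> h y) \<le> diameter (\<pi> x \<union> \<pi> (\<phi> h x))"
    using y by (intro diameter_bounded_bound) (auto simp: bdd)
  finally have far: "diameter (\<pi> x \<union> \<pi> (\<phi> h x)) > C" .
  obtain \<gamma> where \<gamma>: "geodesic_path \<gamma> x (\<phi> h x)"
    using geodesic by blast
  let ?l = "dist x (\<phi> h x)"
  have "setdist (\<pi> x) (\<gamma> ` {0..?l}) \<le> C"
    using constr \<gamma> far unfolding strongly_constricting_map_def by blast
  then have "setdist (\<pi> x) (\<gamma> ` {0..?l}) < C + 1" by simp
  then obtain w v where wv: "w \<in> \<pi> x" "v \<in> \<gamma> ` {0..?l}" "dist w v < C + 1"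
    by (rule setdist_ltE) (use y in auto)
  then obtain s where s: "s \<in> {0..?l}" "v = \<gamma> s" by blast
  have "dist x v + dist v (\<phi> h x) = ?l"
    unfolding s(2) by (rule geodesic_path_split[OF \<gamma> s(1)])
  moreover have "dist w y \<le> C"
    using diameter_bounded_bound[OF bdd wv(1) y] diam_le order_trans by blast
  \<comment> \<open>The three contributions: \<open>C + 1\<close> from \<open>v\<close> to
    \<open>w\<close>, the diameter \<open>C\<close> of \<open>\<pi> x\<close> from \<open>w\<close>
    to \<open>y\<close>, and \<open>D\<close> from \<open>y\<close> to \<open>p\<close>.\<close>
  then have vp: "dist v p \<le> 2 * C + D + 1"
    using wv(3) yp dist_triangle[of v p w] dist_triangle[of w p y] by (simp add: dist_commute)
  moreover have "dist x p \<le> dist x v + dist v p"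
    by (rule dist_triangle)
  moreover have "dist (\<phi> h x) (\<phi> h p) \<le> dist v (\<phi> h x) + dist v p + dist p (\<phi> h p)"
    using dist_triangle[of "\<phi> h x" "\<phi> h p" v] dist_triangle[of v "\<phi> h p" p]
    by (simp add: dist_commute)
  moreover have "dist (\<phi> h x) (\<phi> h p) = dist x p"
    using h by (rule isometric)
  \<comment> \<open>The point \<open>v\<close> cuts the geodesic into two pieces. Each is at least
    \<open>dist x p\<close> up to the error \<open>dist v p\<close>, and for the second piece also
    \<open>dist p (\<phi> h p)\<close>.\<close>
  ultimately have "2 * dist x p \<le> ?l + 2 * (2 * C + D + 1) + dist p (\<phi> h p)"
    by simp
  moreover have "?l = dist p (\<phi> k p)"
    unfolding gk[symmetric] using h by (simp add: x_def dist_action_inv)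
  moreover have "dist x p = dist p (\<phi> g p)"
    by (simp add: x_def dist_action_inv)
  ultimately show ?thesis
    using gk by (intro bexI[of _ g]) auto
qed

end

section \<open>The elementary closure of a strongly contracting element\<close>

locale strongly_contracting_action = G_space +
  fixes p h
  assumes strongly_contracting: "strongly_contracting_element G \<phi> p h"
begin

lemma h_carrier [simp]: "h \<in> carrier G"
  using strongly_contracting by (simp add: strongly_contracting_element_def)

lemma undistorted:
  obtains K L where "K \<ge> 1" "L \<ge> 0"
    "\<And>i j :: int. real_of_int \<bar>i - j\<bar> / K - L \<le> dist (\<phi> (h [^] i) p) (\<phi> (h [^] j) p)"
    "\<And>i j :: int. dist (\<phi> (h [^] i) p) (\<phi> (h [^] j) p) \<le> K * real_of_int \<bar>i - j\<bar> + L"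
  using strongly_contracting unfolding strongly_contracting_element_def quasi_geodesic_def
  by blast

text \<open>A trivial power would have arbitrarily large trivial multiples, contrary to the linear
  lower bound on orbit distances.\<close>

lemma infinite_order: "n \<noteq> 0 \<Longrightarrow> h [^] (n::int) \<noteq> \<one>"
proof
  assume n: "n \<noteq> 0" "h [^] n = \<one>"
  obtain K L where K: "K \<ge> 1" and "L \<ge> 0" and
    low: "\<And>i j :: int. real_of_int \<bar>i - j\<bar> / K - L \<le> dist (\<phi> (h [^] i) p) (\<phi> (h [^] j) p)" and
    "\<And>i j :: int. dist (\<phi> (h [^] i) p) (\<phi> (h [^] j) p) \<le> K * real_of_int \<bar>i - j\<bar> + L"
    using that by (rule undistorted)
  obtain N :: nat where N: "K * L < real N"
    using reals_Archimedean2 by blast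
  have "h [^] (n * int N) = \<one>"
    using n(2) int_pow_pow[OF h_carrier, of n "int N"] by simp
  then have "real_of_int \<bar>n * int N\<bar> / K - L \<le> 0"
    using low[of "n * int N" 0] by simp
  then have "real_of_int \<bar>n\<bar> * real N \<le> K * L"
    using K by (simp add: field_simps abs_mult)
  moreover have "1 * real N \<le> real_of_int \<bar>n\<bar> * real N"
    using n(1) by (intro mult_right_mono) auto
  ultimately show False
    using N by simp
qed

text \<open>The order of quantifiers is the point: the relation satisfied by \<open>g\<close> bounds
  the distance of its translate from \<open>A\<close> only in terms of \<open>g\<close>, and
  \<open>contracted_path\<close> turns this into a bound valid for all \<open>g\<close>.\<close>

lemma commensurator_near_axis:
  "\<exists>B. \<forall>g\<in>commensurator G h. \<exists>i::int. dist (\<phi> g p) (\<phi> (h [^] i) p) \<le> B"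
proof -
  obtain K L where K: "K \<ge> 1" and L: "L \<ge> 0" and
    low: "\<And>i j :: int. real_of_int \<bar>i - j\<bar> / K - L \<le> dist (\<phi> (h [^] i) p) (\<phi> (h [^] j) p)" and
    up: "\<And>i j :: int. dist (\<phi> (h [^] i) p) (\<phi> (h [^] j) p) \<le> K * real_of_int \<bar>i - j\<bar> + L"
    using that by (rule undistorted)
  have gen: "generate G {h} = range (\<lambda>i::int. h [^] i)"
    by (auto simp: generate_pow)
  obtain A \<pi> where cocompact: "acts_cocompactly \<phi> (generate G {h}) A"
    and contr: "strongly_contracting_map A \<pi>"
    using strongly_contracting by (auto simp: strongly_contracting_element_def)
  obtain Q where Q: "compact Q" "A = (\<Union>i::int. \<phi> (h [^] i) ` Q)"
    using cocompact by (auto simp: acts_cocompactly_def gen)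
  have inv_A: "\<phi> (h [^] (i::int)) a \<in> A" if "a \<in> A" for i a
  proof -
    have "\<phi> (h [^] i) ` A \<subseteq> A"
      using cocompact by (simp add: acts_cocompactly_def gen)
    with that show ?thesis by blast
  qed
  obtain C where C: "C \<ge> 0"
      "\<And>x y. dist x y < infdist x A - C \<Longrightarrow> diameter (\<pi> x \<union> \<pi> y) \<le> C"
      "\<And>x. infdist x (\<pi> x) - infdist x A \<le> C"
    using contr by (auto simp: strongly_contracting_map_def)
  have \<pi>: "\<pi> x \<noteq> {}" "\<pi> x \<subseteq> A" "bounded (\<pi> x)" for x
    using contr by (auto simp: strongly_contracting_map_def coarse_map_def)
  obtain a0 where a0: "a0 \<in> A"
    using \<pi> by blast
  have "bounded (insert p Q)"
    using Q(1) by (simp add: compact_imp_bounded)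
  then obtain b where b: "\<And>q. q \<in> Q \<Longrightarrow> dist q p \<le> b"
    by (metis bounded_any_center insertCI dist_commute)
  \<comment> \<open>Taking every \<open>m\<close>-th point of the orbit raises the lower speed from
    \<open>1 / K\<close> to at least \<open>C + 1\<close>.\<close>
  define m :: int where "m = \<lceil>K * (C + 1)\<rceil>"
  have m: "real_of_int m \<ge> K * (C + 1)"
    unfolding m_def by simp
  have "K * (C + 1) > 0"
    using K C(1) by (intro mult_pos_pos) auto
  then have "m > 0"
    using m by linarith
  define s where "s = K * real_of_int m + L"
  define T where "T = s + C + s * (L + 3 * s + 4 * C + 2)"
  have "\<exists>i::int. dist (\<phi> g p) (\<phi> (h [^] i) p) \<le> T + 1 + b" if "g \<in> commensurator G h" for g
  proof -
    obtain c d :: int where [simp]: "g \<in> carrier G" and cd: "c \<noteq> 0" "d \<noteq> 0"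
        and eq: "g \<otimes> h [^] c = h [^] d \<otimes> g"
      using \<open>g \<in> commensurator G h\<close> by (auto simp: commensurator_def)
    define u where "u i = \<phi> g (\<phi> (h [^] (m * i)) p)" for i
    have dist_u: "dist (u i) (u j) = dist (\<phi> (h [^] (m * i)) p) (\<phi> (h [^] (m * j)) p)" for i j
      by (simp add: u_def isometric)
    interpret contracted_path u A \<pi> s C L
    proof
      fix i
      show "dist (u i) (u (i + 1)) \<le> s"
        using up[of "m * i" "m * (i + 1)"] \<open>m > 0\<close> by (simp add: dist_u s_def algebra_simps)
    next
      fix i j
      have "real_of_int \<bar>i - j\<bar> * (C + 1) = real_of_int \<bar>i - j\<bar> * (K * (C + 1)) / K"
        using K by simp
      also have "\<dots> \<le> real_of_int \<bar>i - j\<bar> * real_of_int m / K"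
        using m K by (intro divide_right_mono mult_left_mono) auto
      also have "\<dots> = real_of_int \<bar>m * i - m * j\<bar> / K"
        using \<open>m > 0\<close> by (simp add: abs_mult flip: right_diff_distrib)
      finally show "(C + 1) * real_of_int \<bar>i - j\<bar> - L \<le> dist (u i) (u j)"
        using low[of "m * i" "m * j"] by (simp add: dist_u mult.commute)
    qed (use C \<pi> in auto)
    \<comment> \<open>The a priori bound. With \<open>m * i = c * q + r\<close>, the factor
      \<open>h [^] (c * q)\<close> passes through \<open>g\<close> as \<open>h [^] (d * q)\<close>,
      which preserves \<open>A\<close>. The remainder \<open>r\<close> is bounded by
      \<open>c\<close>.\<close>
    have "infdist (u i) A \<le> K * real_of_int \<bar>c\<bar> + L + dist (\<phi> g p) a0" for i
    proof -
      define q r where "q = m * i div c" and "r = m * i mod c"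
      have "m * i = c * q + r"
        by (simp add: q_def r_def)
      then have "u i = \<phi> (g \<otimes> h [^] (c * q) \<otimes> h [^] r) p"
        by (simp add: u_def int_pow_mult)
      also have "g \<otimes> h [^] (c * q) = h [^] (d * q) \<otimes> g"
        using intertwine_int_pow[OF eq, of q] by (simp add: int_pow_pow)
      finally have "dist (u i) (\<phi> (h [^] (d * q)) a0) = dist (\<phi> g (\<phi> (h [^] r) p)) a0"
        by (simp add: isometric)
      also have "\<dots> \<le> dist (\<phi> g (\<phi> (h [^] r) p)) (\<phi> g p) + dist (\<phi> g p) a0"
        by (rule dist_triangle)
      also have "dist (\<phi> g (\<phi> (h [^] r) p)) (\<phi> g p) \<le> K * real_of_int \<bar>r\<bar> + L"
        using up[of r 0] by (simp add: isometric)
      also have "\<bar>r\<bar> \<le> \<bar>c\<bar>"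
        using abs_mod_less[OF cd(1), of "m * i"] by (simp add: r_def)
      finally show ?thesis
        using K by (intro infdist_le2[OF inv_A[OF a0]]) (auto intro: order_trans)
    qed
    then have "infdist (u 0) A \<le> T"
      unfolding T_def by (rule infdist_uniformly_bounded)
    then have "infdist (\<phi> g p) A < T + 1"
      by (simp add: u_def)
    then obtain a where a: "a \<in> A" "dist (\<phi> g p) a < T + 1"
      using a0 infdist_ltE by (metis empty_iff)
    then obtain i :: int and q where q: "q \<in> Q" "a = \<phi> (h [^] i) q"
      using Q(2) by auto
    have "dist a (\<phi> (h [^] i) p) \<le> b"
      using b[OF q(1)] by (simp add: q(2) isometric)
    then show ?thesis
      using a(2) dist_triangle[of "\<phi> g p" "\<phi> (h [^] i) p" a] by (intro exI[of _ i]) simp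
  qed
  then show ?thesis by blast
qed

text \<open>Translating back along the axis brings each element into one fixed ball, which is finite
  by proper discontinuity.\<close>

lemma commensurator_cover:
  obtains F where "finite F" "F \<subseteq> carrier G"
    "\<And>g. g \<in> commensurator G h \<Longrightarrow> \<exists>i::int. \<exists>f\<in>F. g = h [^] i \<otimes> f"
proof -
  obtain B where B: "\<And>g. g \<in> commensurator G h \<Longrightarrow> \<exists>i::int. dist (\<phi> g p) (\<phi> (h [^] i) p) \<le> B"
    using commensurator_near_axis by blast
  have "\<exists>i::int. \<exists>f\<in>{g \<in> carrier G. dist p (\<phi> g p) \<le> B}. g = h [^] i \<otimes> f"
    if g: "g \<in> commensurator G h" for g
  proof -
    obtain i :: int where i: "dist (\<phi> g p) (\<phi> (h [^] i) p) \<le> B"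
      using B[OF g] by blast
    have [simp]: "g \<in> carrier G"
      using g by (simp add: commensurator_def)
    have "dist p (\<phi> (inv (h [^] i) \<otimes> g) p) \<le> B"
      using i by (simp add: dist_commute[of p] dist_action_inv)
    then show ?thesis
      by (intro exI[of _ i] bexI[of _ "inv (h [^] i) \<otimes> g"]) (simp_all flip: m_assoc)
  qed
  with finite_orbit_near show thesis
    by (intro that[of "{g \<in> carrier G. dist p (\<phi> g p) \<le> B}"]) auto
qed

text \<open>The finite cover makes the commensurator virtually cyclic, and infinite order places
  every virtually cyclic subgroup containing \<open>h\<close> inside it. So the definite description
  has a value.\<close>

lemma elementary_closure_eq: "elementary_closure G h = commensurator G h"
  unfolding elementary_closure_def
proof (rule Greatest_equality)
  have sub: "subgroup (commensurator G h) G"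
    by (simp add: subgroup_commensurator)
  have h: "h \<in> commensurator G h"
    by (rule commensuratorI[of _ _ _ 1 1]) simp_all
  obtain F where "finite F" "F \<subseteq> carrier G"
    "\<And>g. g \<in> commensurator G h \<Longrightarrow> \<exists>i::int. \<exists>f\<in>F. g = h [^] i \<otimes> f"
    using that by (rule commensurator_cover)
  with sub h have "elementary (G\<lparr>carrier := commensurator G h\<rparr>)"
    by (rule elementary_if_finitely_many_cosets)
  with sub h show "subgroup (commensurator G h) G \<and> h \<in> commensurator G h \<and>
      elementary (G\<lparr>carrier := commensurator G h\<rparr>)" by blast
next
  fix K assume "subgroup K G \<and> h \<in> K \<and> elementary (G\<lparr>carrier := K\<rparr>)"
  then show "K \<subseteq> commensurator G h"
    using elementary_subset_commensurator infinite_order by blast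
qed

text \<open>In \<open>g = h [^] i \<otimes> f\<close> the undistorted powers bound the exponent
  \<open>i\<close> linearly in \<open>r\<close>, and there are finitely many
  \<open>f\<close>.\<close>

lemma commensurator_linear_growth:
  obtains \<alpha> \<beta> :: real where "\<alpha> > 0"
    "\<And>r. r \<ge> 0 \<Longrightarrow> real (card {g \<in> commensurator G h. dist p (\<phi> g p) \<le> r}) \<le> \<alpha> * r + \<beta>"
proof -
  obtain K L where K: "K \<ge> 1" and L: "L \<ge> 0" and
    low: "\<And>i j :: int. real_of_int \<bar>i - j\<bar> / K - L \<le> dist (\<phi> (h [^] i) p) (\<phi> (h [^] j) p)" and
    "\<And>i j :: int. dist (\<phi> (h [^] i) p) (\<phi> (h [^] j) p) \<le> K * real_of_int \<bar>i - j\<bar> + L"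
    using that by (rule undistorted)
  obtain F where F: "finite F" "F \<subseteq> carrier G"
    "\<And>g. g \<in> commensurator G h \<Longrightarrow> \<exists>i::int. \<exists>f\<in>F. g = h [^] i \<otimes> f"
    using that by (rule commensurator_cover)
  define B where "B = (\<Sum>f\<in>F. dist p (\<phi> f p))"
  have B: "dist p (\<phi> f p) \<le> B" if "f \<in> F" for f
    unfolding B_def using F(1) that by (intro member_le_sum) auto
  have "B \<ge> 0"
    unfolding B_def by (intro sum_nonneg) auto
  show thesis
  proof (rule that)
    \<comment> \<open>The extra 1 makes the slope positive without a lower bound on
      \<open>card F\<close>.\<close>
    have "2 * K * real (card F) \<ge> 0"
      using K by simp
    then show "2 * K * real (card F) + 1 > 0"
      by linarith
    fix r :: real assume "r \<ge> 0"
    let ?S = "{g \<in> commensurator G h. dist p (\<phi> g p) \<le> r}"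
    define n where "n = \<lfloor>K * (r + B + L)\<rfloor>"
    have "K * (r + B + L) \<ge> 0"
      using K L \<open>B \<ge> 0\<close> \<open>r \<ge> 0\<close> by simp
    then have "n \<ge> 0"
      by (simp add: n_def)
    have "?S \<subseteq> (\<lambda>(i, f). h [^] i \<otimes> f) ` ({- n..n} \<times> F)"
    proof
      fix g assume g: "g \<in> ?S"
      then obtain i :: int and f where f: "f \<in> F" "g = h [^] i \<otimes> f"
        using F(3) by blast
      have [simp]: "f \<in> carrier G"
        using F(2) f(1) by blast
      have "real_of_int \<bar>i\<bar> / K - L \<le> dist (\<phi> (h [^] i) p) p"
        using low[of i 0] by simp
      also have "\<dots> \<le> dist (\<phi> (h [^] i) p) (\<phi> g p) + dist p (\<phi> g p)"
        by (rule dist_triangle2)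
      also have "dist (\<phi> (h [^] i) p) (\<phi> g p) = dist p (\<phi> f p)"
        by (simp add: f(2) isometric)
      finally have "real_of_int \<bar>i\<bar> / K \<le> r + B + L"
        using g B[OF f(1)] by simp
      then have "real_of_int \<bar>i\<bar> \<le> K * (r + B + L)"
        using K by (simp add: field_simps)
      then have "\<bar>i\<bar> \<le> n"
        by (simp add: n_def le_floor_iff)
      then show "g \<in> (\<lambda>(i, f). h [^] i \<otimes> f) ` ({- n..n} \<times> F)"
        using f by (intro image_eqI[of _ _ "(i, f)"]) auto
    qed
    then have "card ?S \<le> card ({- n..n} \<times> F)"
      using F(1) by (intro surj_card_le) auto
    also have "\<dots> = nat (2 * n + 1) * card F"
      by (simp add: card_cartesian_product algebra_simps)
    finally have "real (card ?S) \<le> real (nat (2 * n + 1) * card F)"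
      by (rule of_nat_mono)
    also have "\<dots> = (2 * real_of_int n + 1) * real (card F)"
      using \<open>n \<ge> 0\<close> by simp
    also have "\<dots> \<le> (2 * (K * (r + B + L)) + 1) * real (card F)"
      by (intro mult_right_mono add_right_mono mult_left_mono) (simp_all add: n_def)
    also have "\<dots> \<le> (2 * K * real (card F) + 1) * r + (2 * K * (B + L) + 1) * real (card F)"
      using \<open>r \<ge> 0\<close> by (simp add: algebra_simps)
    finally show "real (card ?S) \<le>
        (2 * K * real (card F) + 1) * r + (2 * K * (B + L) + 1) * real (card F)" .
  qed
qed

section \<open>The two inequalities between the growth exponents\<close>

lemma growth_exponent_conjugacy_class_ge:
  "ereal (1 / 2) * growth_exponent \<phi> p (carrier G) \<le> growth_exponent \<phi> p (conjugacy_class G h)"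
proof -
  obtain \<alpha> \<beta> where \<alpha>: "\<alpha> > 0" and
    lin: "\<And>r. r \<ge> 0 \<Longrightarrow>
      real (card {g \<in> commensurator G h. dist p (\<phi> g p) \<le> r}) \<le> \<alpha> * r + \<beta>"
    using that by (rule commensurator_linear_growth)
  have sub: "commensurator G h \<subseteq> carrier G"
    by (auto simp: commensurator_def)
  have "growth_exponent \<phi> p (carrier G) \<le> ereal 2 * growth_exponent \<phi> p (conjugacy_class G h)"
  proof (rule growth_exponent_le)
    fix r :: real assume r: "r \<ge> 0"
    \<comment> \<open>The centralizer inherits linear growth from the commensurator; the radius
      \<open>2 * r\<close> doubles the slope.\<close>
    have "card {g \<in> centralizer G h. dist p (\<phi> g p) \<le> 2 * r} \<le>
        card {g \<in> commensurator G h. dist p (\<phi> g p) \<le> 2 * r}"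
      using centralizer_subset_commensurator[OF h_carrier]
      by (intro card_mono finite_orbit_ball[OF sub]) auto
    then have "real (card {g \<in> centralizer G h. dist p (\<phi> g p) \<le> 2 * r}) \<le> 2 * \<alpha> * r + \<beta>"
      using lin[of "2 * r"] r by simp
    then show "real (card {g \<in> carrier G. dist p (\<phi> g p) \<le> r}) \<le> (2 * \<alpha> * r + \<beta>) *
        real (card {g \<in> conjugacy_class G h. dist p (\<phi> g p) \<le> 2 * r + dist p (\<phi> h p)})"
      by (rule card_le_conjugacy_class[OF h_carrier])
  qed (use \<alpha> in simp_all)
  then have "ereal (1 / 2) * growth_exponent \<phi> p (carrier G) \<le>
      ereal (1 / 2) * (ereal 2 * growth_exponent \<phi> p (conjugacy_class G h))"
    by (rule ereal_mult_left_mono) simp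
  also have "\<dots> = growth_exponent \<phi> p (conjugacy_class G h)"
    by (simp flip: mult.assoc)
  finally show ?thesis .
qed

lemma growth_exponent_conjugacy_class_le:
  fixes \<pi> C
  defines "H \<equiv> quasi_axis G \<phi> p h"
  assumes equi: "equivariant_map \<phi> (elementary_closure G h) \<pi>"
    and constr: "strongly_constricting_map C H \<pi>" and coarse: "coarse_map C H \<pi>"
    and long: "ereal (dist p (\<phi> h p)) > ereal C + 2 * quotient_diameter \<phi> (centralizer G h) H"
  shows "growth_exponent \<phi> p (conjugacy_class G h) \<le> ereal (1 / 2) * growth_exponent \<phi> p (carrier G)"
proof -
  let ?\<Delta> = "quotient_diameter \<phi> (centralizer G h) H"
  have E: "elementary_closure G h = commensurator G h"
    by (rule elementary_closure_eq)
  have hE: "h \<in> commensurator G h"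
    by (rule commensuratorI[of _ _ _ 1 1]) simp_all
  have "\<one> \<in> commensurator G h"
    using subgroup_commensurator[OF h_carrier] by (rule subgroup.one_closed)
  then have "\<phi> \<one> p \<in> H"
    unfolding H_def quasi_axis_def E by blast
  then have pH: "p \<in> H" by simp
  have "?\<Delta> \<ge> 0"
    unfolding quotient_diameter_def using pH
    by (intro SUP_upper2[of p]) auto
  \<comment> \<open>Nonnegativity excludes minus infinity, and \<open>long\<close> excludes plus
    infinity.\<close>
  with long obtain d where d: "?\<Delta> = ereal d"
    by (cases ?\<Delta>) auto
  with long have d_long: "C + 2 * d < dist p (\<phi> h p)"
    by simp
  \<comment> \<open>The midpoint between \<open>d\<close> and the largest value that
    \<open>long\<close> would allow: \<open>conjugator_dist\<close> needs room on both
    sides.\<close>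
  define D where "D = (d + (dist p (\<phi> h p) - C) / 2) / 2"
  have D: "?\<Delta> < ereal D" "C + 2 * D < dist p (\<phi> h p)"
    using d_long by (simp_all add: d D_def field_simps)
  define c where "c = dist p (\<phi> h p) / 2 + 2 * C + D + 1"
  show ?thesis
  \<comment> \<open>Conjugation of \<open>h\<close> covers the ball of conjugates from a ball of
    about half the radius, so no multiplicity arises. The linear factor \<open>r + 1\<close> is at
    least 1.\<close>
  proof (rule growth_exponent_le[where \<alpha> = 1 and \<beta> = 1 and b = c])
    fix r :: real assume r: "r \<ge> 0"
    let ?B = "{g \<in> carrier G. dist p (\<phi> g p) \<le> 1 / 2 * r + c}"
    have "{k \<in> conjugacy_class G h. dist p (\<phi> k p) \<le> r} \<subseteq> (\<lambda>g. g \<otimes> h \<otimes> inv g) ` ?B"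
    proof
      fix k assume k: "k \<in> {k \<in> conjugacy_class G h. dist p (\<phi> k p) \<le> r}"
      then obtain g where "g \<in> carrier G" "g \<otimes> h \<otimes> inv g = k"
          "dist p (\<phi> g p) \<le> dist p (\<phi> k p) / 2 + c"
        using conjugator_dist[OF h_carrier centralizer_subset_commensurator[OF h_carrier] hE pH
            equi[unfolded E] constr coarse D] unfolding c_def by blast
      with k show "k \<in> (\<lambda>g. g \<otimes> h \<otimes> inv g) ` ?B"
        by (intro image_eqI[of _ _ g]) auto
    qed
    then have "card {k \<in> conjugacy_class G h. dist p (\<phi> k p) \<le> r} \<le> card ?B"
      by (intro surj_card_le finite_orbit_near)
    then have "real (card {k \<in> conjugacy_class G h. dist p (\<phi> k p) \<le> r}) \<le> 1 * real (card ?B)"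
      by simp
    also have "\<dots> \<le> (1 * r + 1) * real (card ?B)"
      using r by (intro mult_right_mono) auto
    finally show "real (card {k \<in> conjugacy_class G h. dist p (\<phi> k p) \<le> r}) \<le>
        (1 * r + 1) * real (card ?B)" .
  qed simp_all
qed

end

theorem theorem7p1:
  fixes G :: "('g, 'b) monoid_scheme"
    and \<phi> :: "'g \<Rightarrow> 'x::metric_space \<Rightarrow> 'x"
    and p :: 'x and h :: 'g
  assumes "G_space G \<phi>"
    and "finitely_generated G"
    and "\<not> elementary G"
    and "strongly_contracting_element G \<phi> p h"
  shows "growth_exponent \<phi> p (conjugacy_class G h) \<ge> ereal (1 / 2) * growth_exponent \<phi> p (carrier G) \<and>
    (\<forall>(\<pi> :: 'x \<Rightarrow> 'x set) (C :: real).
       strongly_contracting_map (quasi_axis G \<phi> p h) \<pi> \<and>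
       equivariant_map \<phi> (elementary_closure G h) \<pi> \<and>
       strongly_constricting_map C (quasi_axis G \<phi> p h) \<pi> \<and>
       coarse_map C (quasi_axis G \<phi> p h) \<pi> \<and>
       ereal (dist p (\<phi> h p)) >
         ereal (15 * C) + 2 * quotient_diameter \<phi> (centralizer G h) (quasi_axis G \<phi> p h)
       \<longrightarrow> growth_exponent \<phi> p (conjugacy_class G h)
             = ereal (1 / 2) * growth_exponent \<phi> p (carrier G))"
proof -
  interpret strongly_contracting_action G \<phi> p h
    using assms(1,4) by (simp add: strongly_contracting_action_def strongly_contracting_action_axioms_def)
  show ?thesis
  proof (intro conjI allI impI)
    show lower: "ereal (1 / 2) * growth_exponent \<phi> p (carrier G) \<le>
        growth_exponent \<phi> p (conjugacy_class G h)"
      by (rule growth_exponent_conjugacy_class_ge)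
    fix \<pi> :: "'x \<Rightarrow> 'x set" and C :: real
    let ?H = "quasi_axis G \<phi> p h"
    let ?D = "quotient_diameter \<phi> (centralizer G h) ?H"
    assume *: "strongly_contracting_map ?H \<pi> \<and> equivariant_map \<phi> (elementary_closure G h) \<pi> \<and>
      strongly_constricting_map C ?H \<pi> \<and> coarse_map C ?H \<pi> \<and>
      ereal (dist p (\<phi> h p)) > ereal (15 * C) + 2 * ?D"
    \<comment> \<open>\<open>C\<close> bounds the diameters of the bounded sets
      \<open>\<pi> x\<close>, so it is nonnegative and \<open>C \<le> 15 * C\<close>.\<close>
    then have "C \<ge> 0"
      unfolding coarse_map_def using diameter_ge_0 order_trans by blast
    then have "ereal C + 2 * ?D \<le> ereal (15 * C) + 2 * ?D"
      by (intro add_right_mono) simp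
    with * have "ereal (dist p (\<phi> h p)) > ereal C + 2 * ?D"
      by (meson le_less_trans)
    with * have "growth_exponent \<phi> p (conjugacy_class G h) \<le>
        ereal (1 / 2) * growth_exponent \<phi> p (carrier G)"
      using growth_exponent_conjugacy_class_le by blast
    with lower show "growth_exponent \<phi> p (conjugacy_class G h) =
        ereal (1 / 2) * growth_exponent \<phi> p (carrier G)"
      by (rule order_antisym[rotated])
  qed
qed

end
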